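(* Let $X$ be a Banach space and let $\alpha>\kappa\ge0$ be real numbers. (1) Let $\omega\in\mathbb R$ and let $\{R(\lambda)\}_{\lambda\in\Omega}\subset\mathcal L(X)$ be a pseudo-resolvent with $(\omega,\infty)\subset\Omega\subset\mathbb C$. If there exist $M>0$ and $a\ge\max\{\omega,0\}$ such that $$\sup_{n\in\mathbb N\cup\{0\},\ \lambda>a}\left\|\frac{(\lambda-\omega)^{n+\alpha+1}}{\Gamma(n+\alpha+1)}\,\frac{d^n}{d\lambda^n}\left(\frac{R(\lambda)}{\lambda^\kappa}\right)\right\|\le M,$$ then $R(\lambda)=0$ for all $\lambda\in\Omega$. (2) Consequently, a $\kappa$-times integrated semigroup $\{S(t)\}_{t\ge0}$ on $X$ satisfying $\|S(t)\|=\mathcal O(t^\alpha)$ as $t\to0$ is necessarily trivial: $S(t)=0$ for all $t\ge0$.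
   Context: A pseudo-resolvent is a family $\{R(\lambda)\}_{\lambda\in\Omega}\subset\mathcal L(X)$ of bounded operators satisfying $R(\lambda)-R(\mu)=(\mu-\lambda)R(\lambda)R(\mu)$ for $\lambda,\mu\in\Omega$; it is regarded as the resolvent of a (possibly multivalued) closed linear operator. For $\kappa\ge0$, a (possibly multivalued) closed linear operator $A$ on $X$ with nonempty resolvent set $\rho(A)$ generates a $\kappa$-times integrated semigroup $S$ if there exist $\omega_0\ge0$ and a strongly continuous function $S:[0,\infty)\to\mathcal L(X)$ having a Laplace transform for $\lambda>\omega_0$ such that $(\omega_0,\infty)\subset\rho(A)$ and $R(\lambda,A)=\lambda^\kappa\int_0^\infty e^{-\lambda t}S(t)\,dt$ for $\lambda>\omega_0$ (integrals understood strongly). *)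

theory Defs
  imports "HOL-Analysis.Analysis" "HOL-Library.Landau_Symbols"
begin

class scaleC =
  fixes scaleC :: "complex \<Rightarrow> 'a \<Rightarrow> 'a"  (infixr \<open>*\<^sub>C\<close> 75)

text \<open>A complex Banach space is a real one whose scalar multiplication extends to \<open>complex\<close>
  compatibly with the norm; the norm and topology are those of the underlying real space.\<close>

class complex_banach = scaleC + banach +
  assumes scaleC_add_right: "c *\<^sub>C (x + y) = c *\<^sub>C x + c *\<^sub>C y"
    and scaleC_add_left: "(c + d) *\<^sub>C x = c *\<^sub>C x + d *\<^sub>C x"
    and scaleC_scaleC: "c *\<^sub>C (d *\<^sub>C x) = (c * d) *\<^sub>C x"
    and scaleC_of_real: "complex_of_real r *\<^sub>C x = r *\<^sub>R x"
    and norm_scaleC: "norm (c *\<^sub>C x) = cmod c * norm x"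

instantiation complex :: complex_banach
begin

definition scaleC_complex_def: "c *\<^sub>C x = c * (x :: complex)"

instance
  by standard
    (simp_all add: scaleC_complex_def algebra_simps norm_mult scaleR_conv_of_real)

end

text \<open>The type \<open>'a \<Rightarrow>\<^sub>L 'a\<close> consists of real-linear bounded operators. The algebra
  of bounded complex-linear operators is its subset below; the operator norm does not depend on
  the choice of the scalar field.\<close>

definition bounded_ops :: "('a::complex_banach \<Rightarrow>\<^sub>L 'a) set" where
  "bounded_ops = {T. \<forall>c x. blinfun_apply T (c *\<^sub>C x) = c *\<^sub>C blinfun_apply T x}"

definition pseudo_resolvent ::
    "complex set \<Rightarrow> (complex \<Rightarrow> 'a::complex_banach \<Rightarrow>\<^sub>L 'a) \<Rightarrow> bool" where
  "pseudo_resolvent \<Omega> R \<longleftrightarrow>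
     (\<forall>l\<in>\<Omega>. R l \<in> bounded_ops) \<and>
     (\<forall>l\<in>\<Omega>. \<forall>m\<in>\<Omega>. \<forall>x. R l x - R m x = (m - l) *\<^sub>C R l (R m x))"

text \<open>The iterated derivative of a vector-valued function of a real variable. For functions into
  \<open>'a \<Rightarrow>\<^sub>L 'a\<close> it is taken in the operator norm. On an open real interval contained
  in \<open>\<Omega>\<close>, a pseudo-resolvent is infinitely differentiable in this sense, so that no
  differentiability hypothesis is needed there.\<close>

definition nth_vector_derivative ::
    "nat \<Rightarrow> (real \<Rightarrow> 'b::real_normed_vector) \<Rightarrow> real \<Rightarrow> 'b" where
  "nth_vector_derivative n f = ((\<lambda>g t. vector_derivative g (at t)) ^^ n) f"

text \<open>Multivalued operators are represented by their graphs: \<open>(x, y) \<in> A\<close> means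
  \<open>y \<in> A x\<close>.\<close>

definition closed_linear_relation :: "('a::complex_banach \<times> 'a) set \<Rightarrow> bool" where
  "closed_linear_relation A \<longleftrightarrow>
     closed A \<and> (0, 0) \<in> A \<and>
     (\<forall>x y x' y'. (x, y) \<in> A \<longrightarrow> (x', y') \<in> A \<longrightarrow> (x + x', y + y') \<in> A) \<and>
     (\<forall>c x y. (x, y) \<in> A \<longrightarrow> (c *\<^sub>C x, c *\<^sub>C y) \<in> A)"

definition shifted_relation ::
    "complex \<Rightarrow> ('a::complex_banach \<times> 'a) set \<Rightarrow> ('a \<times> 'a) set" where
  "shifted_relation l A = {(x, l *\<^sub>C x - y) | x y. (x, y) \<in> A}"

text \<open>\<open>T\<close> is an everywhere defined, single-valued, bounded inverse of \<open>l - A\<close>.\<close>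

definition is_resolvent ::
    "complex \<Rightarrow> ('a::complex_banach \<times> 'a) set \<Rightarrow> ('a \<Rightarrow>\<^sub>L 'a) \<Rightarrow> bool" where
  "is_resolvent l A T \<longleftrightarrow>
     T \<in> bounded_ops \<and> converse (shifted_relation l A) = {(x, T x) | x. True}"

definition resolvent_set :: "('a::complex_banach \<times> 'a) set \<Rightarrow> complex set" where
  "resolvent_set A = {l. \<exists>T. is_resolvent l A T}"

definition resolvent ::
    "complex \<Rightarrow> ('a::complex_banach \<times> 'a) set \<Rightarrow> 'a \<Rightarrow>\<^sub>L 'a" where
  "resolvent l A = (THE T. is_resolvent l A T)"

lemma is_resolvent_unique:
  assumes "is_resolvent l A T" "is_resolvent l A T'"
  shows "T = T'"
  using assms unfolding is_resolvent_def by (intro blinfun_eqI) blast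

lemma is_resolvent_resolvent:
  assumes "l \<in> resolvent_set A"
  shows "is_resolvent l A (resolvent l A)"
proof -
  obtain T where T: "is_resolvent l A T"
    using assms by (auto simp: resolvent_set_def)
  then show ?thesis
    unfolding resolvent_def by (rule theI) (rule is_resolvent_unique[OF _ T])
qed

text \<open>Only the values of \<open>S\<close> on \<open>{0..}\<close> matter. The integral over \<open>{0..}\<close> of
  a function continuous on \<open>{0..}\<close> is the improper integral, that is, the limit of the
  integrals over \<open>{0..T}\<close> as \<open>T\<close> tends to infinity; absolute convergence is not
  required.\<close>

definition generates_integrated_semigroup ::
    "real \<Rightarrow> ('a::complex_banach \<times> 'a) set \<Rightarrow> (real \<Rightarrow> 'a \<Rightarrow>\<^sub>L 'a) \<Rightarrow> bool" where
  "generates_integrated_semigroup \<kappa> A S \<longleftrightarrow>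
     closed_linear_relation A \<and> resolvent_set A \<noteq> {} \<and>
     (\<forall>t\<ge>0. S t \<in> bounded_ops) \<and>
     (\<forall>x. continuous_on {0..} (\<lambda>t. S t x)) \<and>
     (\<exists>\<omega>\<^sub>0\<ge>0. complex_of_real ` {\<omega>\<^sub>0<..} \<subseteq> resolvent_set A \<and>
        (\<forall>l>\<omega>\<^sub>0. \<forall>x.
           (\<lambda>t. exp (- l * t) *\<^sub>R S t x) integrable_on {0..} \<and>
           resolvent (complex_of_real l) A x =
             (l powr \<kappa>) *\<^sub>R integral {0..} (\<lambda>t. exp (- l * t) *\<^sub>R S t x)))"

definition integrated_semigroup ::
    "real \<Rightarrow> (real \<Rightarrow> 'a::complex_banach \<Rightarrow>\<^sub>L 'a) \<Rightarrow> bool" where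
  "integrated_semigroup \<kappa> S \<longleftrightarrow> (\<exists>A. generates_integrated_semigroup \<kappa> A S)"

end

theory Submission
  imports Defs "HOL-Real_Asymp.Real_Asymp"
begin

text \<open>If \<open>s R(s) x\<close> tends to \<open>0\<close> as \<open>s\<close> tends to infinity, then letting \<open>s\<close> tend to infinity in
  \<open>R(l) x = R(s) x + (s - l) R(l) R(s) x\<close> gives \<open>R(l) x = 0\<close>. The bound in (1) for \<open>n = 0\<close> alone
  gives \<open>R(s) = O(s powr (\<kappa> - \<alpha> - 1))\<close>, which suffices. In (2) only conditional convergence of the
  Laplace integral is available, so the same decay is obtained by an integration by parts from
  the bounded primitive of \<open>exp (- b t) S(t) x\<close>, which is \<open>O(t powr (\<alpha> + 1))\<close> on \<open>[0, \<infinity>)\<close>;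
  hence the resolvent vanishes, and so does \<open>S\<close> by uniqueness of the Laplace transform.\<close>

section \<open>Resolvent identities and decay at infinity\<close>

lemma scaleC_diff_left: "(c - d) *\<^sub>C x = c *\<^sub>C x - d *\<^sub>C (x :: 'a::complex_banach)"
  using scaleC_add_left[of "c - d" d x] by (simp add: algebra_simps)

text \<open>For \<open>y\<close> in \<open>A\<close> at \<open>z = resolvent m A x\<close> with
  \<open>x = m z - y\<close>, the element \<open>l z - y = x - (m - l) z\<close> lies in
  \<open>(l - A) z\<close>. Applying \<open>resolvent l A\<close> to it returns \<open>z\<close>,
  which is the resolvent identity. Working with a chosen \<open>y\<close> accommodates multivalued
  \<open>A\<close>.\<close>

lemma pseudo_resolvent_resolvent:
  "pseudo_resolvent (resolvent_set A) (\<lambda>l. resolvent l A)"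
  unfolding pseudo_resolvent_def
proof (intro conjI ballI allI)
  fix l assume "l \<in> resolvent_set A"
  then show "resolvent l A \<in> bounded_ops"
    using is_resolvent_resolvent is_resolvent_def by blast
next
  fix l m :: complex and x :: 'a
  assume "l \<in> resolvent_set A" "m \<in> resolvent_set A"
  then have l: "is_resolvent l A (resolvent l A)" and m: "is_resolvent m A (resolvent m A)"
    by (auto intro: is_resolvent_resolvent)
  have "(x, resolvent m A x) \<in> converse (shifted_relation m A)"
    using m by (simp add: is_resolvent_def)
  then obtain y where y: "(resolvent m A x, y) \<in> A" "x = m *\<^sub>C resolvent m A x - y"
    by (auto simp: shifted_relation_def)
  then have "(l *\<^sub>C resolvent m A x - y, resolvent m A x) \<in> converse (shifted_relation l A)"
    by (auto simp: shifted_relation_def)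
  then have "resolvent m A x = resolvent l A (l *\<^sub>C resolvent m A x - y)"
    using l by (auto simp: is_resolvent_def)
  also have "l *\<^sub>C resolvent m A x - y = x - (m - l) *\<^sub>C resolvent m A x"
    using y(2) by (simp add: scaleC_diff_left algebra_simps)
  also have "resolvent l A \<dots> = resolvent l A x - (m - l) *\<^sub>C resolvent l A (resolvent m A x)"
    using l by (simp add: blinfun.diff_right is_resolvent_def bounded_ops_def)
  finally show "resolvent l A x - resolvent m A x = (m - l) *\<^sub>C resolvent l A (resolvent m A x)"
    by (simp add: algebra_simps)
qed

lemma pseudo_resolvent_eq_0:
  assumes R: "pseudo_resolvent \<Omega> R" and \<Omega>: "complex_of_real ` {\<omega><..} \<subseteq> \<Omega>" and l: "l \<in> \<Omega>"
    and lim: "((\<lambda>s. s *\<^sub>R R (complex_of_real s) x) \<longlongrightarrow> 0) at_top"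
  shows "R l x = 0"
proof -
  define r where "r s = R (complex_of_real s) x" for s
  have nlim: "((\<lambda>s. norm (s *\<^sub>R r s)) \<longlongrightarrow> 0) at_top"
    using tendsto_norm[OF lim] by (simp add: r_def)
  have inv: "((\<lambda>s. inverse s :: real) \<longlongrightarrow> 0) at_top" by real_asymp
  have "((\<lambda>s. inverse s *\<^sub>R (s *\<^sub>R r s)) \<longlongrightarrow> 0 *\<^sub>R 0) at_top"
    unfolding r_def by (rule tendsto_scaleR[OF inv lim])
  moreover have "\<forall>\<^sub>F s in at_top. inverse s *\<^sub>R (s *\<^sub>R r s) = r s"
    using eventually_gt_at_top[of 0] by eventually_elim simp
  ultimately have r0: "(r \<longlongrightarrow> 0) at_top"
    using Lim_transform_eventually by fastforce
  \<comment> \<open>The factor \<open>s - l\<close> of the resolvent identity is split: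
    \<open>s\<close> joins \<open>r s\<close> to form the quantity that vanishes by assumption, and
    \<open>l\<close> stays with \<open>r s\<close>, which vanishes as well.\<close>
  have "((\<lambda>s. norm (s *\<^sub>R r s) * norm (R l) + cmod l * norm (R l) * norm (r s)) \<longlongrightarrow>
          0 * norm (R l) + cmod l * norm (R l) * norm (0 :: 'a)) at_top"
    by (intro tendsto_intros nlim r0)
  moreover have "\<forall>\<^sub>F s in at_top. norm (R l x - r s) \<le>
      norm (s *\<^sub>R r s) * norm (R l) + cmod l * norm (R l) * norm (r s)"
    using eventually_gt_at_top[of "max 0 \<omega>"]
  proof eventually_elim
    case (elim s)
    then have s: "complex_of_real s \<in> \<Omega>" "s > 0" using \<Omega> by auto
    have "norm (R l x - r s) = cmod (complex_of_real s - l) * norm (R l (r s))"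
      using R l s unfolding pseudo_resolvent_def r_def by (simp add: norm_scaleC)
    also have "\<dots> \<le> (s + cmod l) * (norm (R l) * norm (r s))"
      using norm_triangle_ineq4[of "complex_of_real s" l] s
      by (intro mult_mono norm_blinfun) auto
    finally show ?case using s by (simp add: algebra_simps)
  qed
  ultimately have "((\<lambda>s. R l x - r s) \<longlongrightarrow> 0) at_top"
    by (intro Lim_null_comparison[of "\<lambda>s. R l x - r s"]) auto
  moreover have "((\<lambda>s. R l x - r s) \<longlongrightarrow> R l x - 0) at_top"
    by (intro tendsto_intros r0)
  ultimately show ?thesis
    using tendsto_unique trivial_limit_at_top_linorder by fastforce
qed

section \<open>Improper integrals and primitives on the half-line\<close>

text \<open>The gauge integral over an unbounded set is a limit over all boxes containing a large
  ball. The boxes from \<open>-T\<close> to \<open>T\<close> form such a family, and they meet the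
  half-line in \<open>{0..T}\<close>.\<close>

lemma tendsto_integral_at_top:
  fixes f :: "real \<Rightarrow> 'a::banach"
  assumes "f integrable_on {0..}"
  shows "((\<lambda>T. integral {0..T} f) \<longlongrightarrow> integral {0..} f) at_top"
proof (rule tendstoI)
  fix e :: real assume "e > 0"
  \<comment> \<open>Not being a box puts \<open>{0..}\<close> under the unbounded clause of the
    definition of \<open>has_integral\<close>.\<close>
  have nb: "\<not> (\<exists>a b. {0::real..} = cbox a b)"
  proof
    assume "\<exists>a b. {0::real..} = cbox a b"
    then obtain a b where "{0::real..} = {a..b}" by auto
    moreover have "max b 0 + 1 \<in> {0::real..}" "max b 0 + 1 \<notin> {a..b}" by auto
    ultimately show False by blast
  qed
  obtain B where B: "B > 0" "\<And>a b. ball 0 B \<subseteq> cbox a b \<Longrightarrow>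
      \<exists>z. ((\<lambda>x. if x \<in> {0..} then f x else 0) has_integral z) (cbox a b) \<and>
        norm (z - integral {0..} f) < e"
    using has_integral_altD[OF integrable_integral[OF assms] nb \<open>e > 0\<close>] by metis
  show "\<forall>\<^sub>F T in at_top. dist (integral {0..T} f) (integral {0..} f) < e"
    using eventually_gt_at_top[of B]
  proof eventually_elim
    case (elim T)
    then have "ball 0 B \<subseteq> cbox (-T) T" by (auto simp: dist_real_def)
    from B(2)[OF this] obtain z where z:
      "((\<lambda>x. if x \<in> {0..} then f x else 0) has_integral z) {-T..T}"
      "norm (z - integral {0..} f) < e" by auto
    then have "(f has_integral z) ({0..} \<inter> {-T..T})"
      using has_integral_restrict_Int[of "{0..}" f z "{-T..T}"] by simp
    moreover have "{0..} \<inter> {-T..T} = {0..T}" using elim B by auto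
    ultimately have "(f has_integral z) {0..T}" by (simp only:)
    then show ?case using z by (simp add: dist_norm integral_unique)
  qed
qed

lemma primitive_has_vector_derivative:
  fixes f :: "real \<Rightarrow> 'a::banach"
  assumes "continuous_on {0..} f" "t \<in> {0..T}"
  shows "((\<lambda>t. integral {0..t} f) has_vector_derivative f t) (at t within {0..T})"
  using assms by (intro integral_has_vector_derivative) (auto intro: continuous_on_subset)

lemma continuous_on_primitive:
  fixes f :: "real \<Rightarrow> 'a::banach"
  assumes f: "continuous_on {0..} f"
  shows "continuous_on {0..} (\<lambda>t. integral {0..t} f)"
proof (clarsimp simp: continuous_on_eq_continuous_within)
  fix t :: real assume t: "0 \<le> t"
  \<comment> \<open>The right endpoint lies beyond \<open>t\<close>, so near \<open>t\<close> this
    interval agrees with the half-line.\<close>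
  have "continuous (at t within {0..t+1}) (\<lambda>t. integral {0..t} f)"
    using primitive_has_vector_derivative[OF f, of t "t+1"] t
    by (intro has_vector_derivative_continuous) auto
  moreover have "at t within {0..t+1} = at t within {0..}"
    by (rule at_within_nhd[of _ "{..<t+1}"]) auto
  ultimately show "continuous (at t within {0..}) (\<lambda>t. integral {0..t} f)"
    by simp
qed

text \<open>Convergence at infinity controls the primitive beyond some \<open>N\<close>, and
  compactness controls it on \<open>{0..N}\<close>.\<close>

lemma bounded_primitive:
  fixes f :: "real \<Rightarrow> 'a::banach"
  assumes f: "continuous_on {0..} f" "f integrable_on {0..}"
  obtains B where "B > 0" "\<And>t. t \<ge> 0 \<Longrightarrow> norm (integral {0..t} f) \<le> B"
proof -
  have "\<forall>\<^sub>F T in at_top. dist (integral {0..T} f) (integral {0..} f) < 1"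
    using tendsto_integral_at_top[OF f(2)] by (rule tendstoD) simp
  then obtain N where N: "\<And>T. T \<ge> N \<Longrightarrow> dist (integral {0..T} f) (integral {0..} f) < 1"
    by (auto simp: eventually_at_top_linorder)
  have "compact ((\<lambda>t. integral {0..t} f) ` {0..N})"
    by (intro compact_continuous_image continuous_on_subset[OF continuous_on_primitive[OF f(1)]]) auto
  then obtain K where K: "\<And>t. t \<in> {0..N} \<Longrightarrow> norm (integral {0..t} f) \<le> K"
    by (meson bounded_iff compact_imp_bounded imageI)
  show thesis
  proof (rule that)
    \<comment> \<open>If \<open>N\<close> is negative, \<open>{0..N}\<close> is empty and
      \<open>K\<close> may be negative, hence the maximum with 0.\<close>
    show "max K 0 + norm (integral {0..} f) + 1 > 0"
      by (smt (verit) norm_ge_zero)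
    fix t :: real assume t: "t \<ge> 0"
    show "norm (integral {0..t} f) \<le> max K 0 + norm (integral {0..} f) + 1"
    proof (cases "t \<le> N")
      case True
      then have "norm (integral {0..t} f) \<le> max K 0"
        using K[of t] t by (simp add: le_max_iff_disj)
      then show ?thesis using norm_ge_zero[of "integral {0..} f"] by linarith
    next
      case False
      then have "norm (integral {0..t} f - integral {0..} f) < 1"
        using N[of t] by (simp add: dist_norm)
      then show ?thesis
        using norm_triangle_sub[of "integral {0..t} f" "integral {0..} f"] by linarith
    qed
  qed
qed

section \<open>Decay of Laplace transforms\<close>

text \<open>Trades an integral that may converge only conditionally for a boundary term and the
  transform of the primitive, both of which can be estimated in norm.\<close>

lemma laplace_by_parts:
  fixes f :: "real \<Rightarrow> 'a::banach"
  assumes f: "continuous_on {0..} f" and T: "T \<ge> 0"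
  shows "integral {0..T} (\<lambda>t. exp (- p * t) *\<^sub>R f t) =
    exp (- p * T) *\<^sub>R integral {0..T} f +
    p *\<^sub>R integral {0..T} (\<lambda>t. exp (- p * t) *\<^sub>R integral {0..t} f)"
proof -
  let ?F = "\<lambda>t. integral {0..t} f"
  have "((\<lambda>t. exp (- p * t) *\<^sub>R f t + (- p * exp (- p * t)) *\<^sub>R ?F t) has_integral
      exp (- p * T) *\<^sub>R ?F T - exp (- p * 0) *\<^sub>R ?F 0) {0..T}"
  proof (rule fundamental_theorem_of_calculus[OF T])
    fix t assume t: "t \<in> {0..T}"
    have "((\<lambda>t. exp (- p * t)) has_field_derivative - p * exp (- p * t)) (at t within {0..T})"
      by (auto intro!: derivative_eq_intros)
    then show "((\<lambda>t. exp (- p * t) *\<^sub>R ?F t) has_vector_derivative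
        exp (- p * t) *\<^sub>R f t + (- p * exp (- p * t)) *\<^sub>R ?F t) (at t within {0..T})"
      by (rule has_vector_derivative_scaleR[OF _ primitive_has_vector_derivative[OF f t]])
  qed
  then have 1: "integral {0..T} (\<lambda>t. exp (- p * t) *\<^sub>R f t + (- p * exp (- p * t)) *\<^sub>R ?F t) =
      exp (- p * T) *\<^sub>R ?F T"
    by (simp add: integral_unique)
  have c: "continuous_on {0..T} f" "continuous_on {0..T} ?F"
    using f continuous_on_primitive[OF f] by (auto intro: continuous_on_subset)
  have "integral {0..T} (\<lambda>t. exp (- p * t) *\<^sub>R f t + (- p * exp (- p * t)) *\<^sub>R ?F t) =
     integral {0..T} (\<lambda>t. exp (- p * t) *\<^sub>R f t) +
     integral {0..T} (\<lambda>t. (- p * exp (- p * t)) *\<^sub>R ?F t)"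
    by (intro integral_add integrable_continuous_real continuous_intros c)
  also have "integral {0..T} (\<lambda>t. (- p * exp (- p * t)) *\<^sub>R ?F t) =
      (- p) *\<^sub>R integral {0..T} (\<lambda>t. exp (- p * t) *\<^sub>R ?F t)"
    by (simp only: scaleR_scaleR[symmetric] integral_cmul)
  finally show ?thesis using 1 by (simp add: algebra_simps)
qed

text \<open>This is \<open>1 + y \<le> exp y\<close> at \<open>y = x / (2 * a)\<close>, raised to
  the power \<open>a\<close>. It lets half of an exponential decay absorb a power, in place of an
  evaluation by the Gamma integral.\<close>

lemma powr_le_exp_half:
  fixes x a :: real
  assumes "x \<ge> 0" "a > 0"
  shows "x powr a \<le> (2 * a) powr a * exp (x / 2)"
proof -
  have "x / (2 * a) \<le> exp (x / (2 * a))"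
    using exp_ge_add_one_self[of "x / (2 * a)"] by linarith
  then have "(x / (2 * a)) powr a \<le> exp (x / (2 * a)) powr a"
    using assms by (intro powr_mono2) auto
  also have "\<dots> = exp (x / 2)"
    using assms by (simp add: powr_def)
  finally show ?thesis
    using assms by (simp add: powr_divide field_simps)
qed

text \<open>After integration by parts, the power bound on the primitive leaves an integrand of size
  at most \<open>D * exp (- (p / 2) * t)\<close>. Its integral is at most \<open>2 * D / p\<close>,
  the prefactor \<open>p\<close> cancels the denominator, and the boundary term dies as
  \<open>T\<close> grows.\<close>

lemma norm_laplace_le:
  fixes f :: "real \<Rightarrow> 'a::banach"
  assumes f: "continuous_on {0..} f" "f integrable_on {0..}"
    and p: "p > 0" and a: "a > 0"
    and int: "(\<lambda>t. exp (- p * t) *\<^sub>R f t) integrable_on {0..}"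
    and F: "\<And>t. t \<ge> 0 \<Longrightarrow> norm (integral {0..t} f) \<le> C * t powr a"
  shows "norm (integral {0..} (\<lambda>t. exp (- p * t) *\<^sub>R f t)) \<le> 2 * C * (2 * a) powr a * p powr (- a)"
proof -
  let ?F = "\<lambda>t. integral {0..t} f"
  \<comment> \<open>At \<open>t = 1\<close> the power equals 1.\<close>
  have C: "C \<ge> 0" using order_trans[OF norm_ge_zero F[of 1]] by simp
  define D where "D = C * (2 * a) powr a * p powr (- a)"
  have D: "D \<ge> 0" using C by (simp add: D_def)
  have Fb: "norm (exp (- p * t) *\<^sub>R ?F t) \<le> D * exp (- (p / 2) * t)" if "t \<ge> 0" for t
  proof -
    have "norm (?F t) \<le> C * t powr a" by (rule F[OF that])
    also have "\<dots> = C * p powr (- a) * (p * t) powr a"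
      using p that by (simp add: powr_mult powr_minus field_simps)
    also have "\<dots> \<le> C * p powr (- a) * ((2 * a) powr a * exp (p * t / 2))"
      using p that a C by (intro mult_left_mono powr_le_exp_half) auto
    finally have "exp (- p * t) * norm (?F t) \<le> exp (- p * t) * (D * exp (p * t / 2))"
      by (simp add: D_def mult_ac)
    also have "\<dots> = D * (exp (- p * t) * exp (p * t / 2))" by simp
    also have "exp (- p * t) * exp (p * t / 2) = exp (- (p / 2) * t)"
      by (simp add: exp_add[symmetric])
    finally show ?thesis by simp
  qed
  have bound: "norm (integral {0..T} (\<lambda>t. exp (- p * t) *\<^sub>R f t)) \<le> D * exp (- (p / 2) * T) + 2 * D"
    if T: "T \<ge> 0" for T
  proof -
    have cF: "continuous_on {0..T} ?F"
      using continuous_on_primitive[OF f(1)] by (auto intro: continuous_on_subset)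
    have "((\<lambda>t. D * exp (- (p / 2) * t)) has_integral
        (- 2 * D / p * exp (- (p / 2) * T)) - (- 2 * D / p * exp (- (p / 2) * 0))) {0..T}"
      using p by (intro fundamental_theorem_of_calculus[OF T])
        (auto intro!: derivative_eq_intros simp: has_real_derivative_iff_has_vector_derivative[symmetric])
    then have i: "(\<lambda>t. D * exp (- (p / 2) * t)) integrable_on {0..T}"
      and e: "integral {0..T} (\<lambda>t. D * exp (- (p / 2) * t)) \<le> 2 * D / p"
      using p D by (blast intro: has_integral_integrable, subst integral_unique) auto
    have "norm (integral {0..T} (\<lambda>t. exp (- p * t) *\<^sub>R ?F t)) \<le>
        integral {0..T} (\<lambda>t. D * exp (- (p / 2) * t))"
      by (intro integral_norm_bound_integral integrable_continuous_real continuous_intros cF i)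
         (use Fb in auto)
    then have "p * norm (integral {0..T} (\<lambda>t. exp (- p * t) *\<^sub>R ?F t)) \<le> p * (2 * D / p)"
      using e p by (intro mult_left_mono) auto
    then have "norm (p *\<^sub>R integral {0..T} (\<lambda>t. exp (- p * t) *\<^sub>R ?F t)) \<le> 2 * D"
      using p by simp
    then show ?thesis
      unfolding laplace_by_parts[OF f(1) T]
      using Fb[OF T] norm_triangle_ineq
      by (smt (verit))
  qed
  have "((\<lambda>T. D * exp (- (p / 2) * T) + 2 * D) \<longlongrightarrow> 2 * D) at_top"
    using p by real_asymp
  moreover have "((\<lambda>T. norm (integral {0..T} (\<lambda>t. exp (- p * t) *\<^sub>R f t))) \<longlongrightarrow>
      norm (integral {0..} (\<lambda>t. exp (- p * t) *\<^sub>R f t))) at_top"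
    by (intro tendsto_norm tendsto_integral_at_top int)
  ultimately have "norm (integral {0..} (\<lambda>t. exp (- p * t) *\<^sub>R f t)) \<le> 2 * D"
    by (rule tendsto_le[OF trivial_limit_at_top_linorder])
       (rule eventually_mono[OF eventually_ge_at_top bound])
  then show ?thesis by (simp add: D_def mult.assoc)
qed

section \<open>Vanishing moments and uniqueness of the Laplace transform\<close>

text \<open>Polynomials integrate to zero against \<open>g\<close> by linearity, and the Weierstrass
  theorem approximates \<phi> by them uniformly.\<close>

lemma integral_continuous_eq_0_of_moments:
  fixes g :: "real \<Rightarrow> 'a::banach" and \<phi> :: "real \<Rightarrow> real"
  assumes g: "continuous_on {0..1} g" and \<phi>: "continuous_on {0..1} \<phi>"
    and moments: "\<And>n. integral {0..1} (\<lambda>u. u ^ n *\<^sub>R g u) = 0"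
  shows "integral {0..1} (\<lambda>u. \<phi> u *\<^sub>R g u) = 0"
proof -
  have "bounded (g ` {0..1})"
    by (intro compact_imp_bounded compact_continuous_image g) auto
  then obtain B where B: "B > 0" "\<And>u. u \<in> {0..1} \<Longrightarrow> norm (g u) \<le> B"
    by (auto simp: bounded_pos)
  have "norm (integral {0..1} (\<lambda>u. \<phi> u *\<^sub>R g u)) \<le> e" if "e > 0" for e
  proof -
    \<comment> \<open>Accuracy \<open>e / B\<close> becomes \<open>e\<close> after multiplication by
      \<open>g\<close>, whose norm is at most \<open>B\<close>.\<close>
    have "e / B > 0" using that B by simp
    from Stone_Weierstrass_real_polynomial_function[OF compact_Icc \<phi> this]
    obtain q where q: "real_polynomial_function q"
      and q': "\<And>u. u \<in> {0..1} \<Longrightarrow> \<bar>\<phi> u - q u\<bar> < e / B" by auto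
    obtain a n where qs: "q = (\<lambda>u. \<Sum>i\<le>n. a i * u ^ i)"
      using q by (auto simp: real_polynomial_function_iff_sum)
    have "integral {0..1} (\<lambda>u. q u *\<^sub>R g u) =
        integral {0..1} (\<lambda>u. \<Sum>i\<le>n. a i *\<^sub>R (u ^ i *\<^sub>R g u))"
      by (simp add: qs scaleR_sum_left)
    also have "\<dots> = (\<Sum>i\<le>n. integral {0..1} (\<lambda>u. a i *\<^sub>R (u ^ i *\<^sub>R g u)))"
      by (intro integral_sum integrable_continuous_real continuous_intros g) auto
    also have "\<dots> = 0"
      using moments by (simp only: integral_cmul) simp
    finally have q0: "integral {0..1} (\<lambda>u. q u *\<^sub>R g u) = 0" .
    have cq: "continuous_on {0..1} q"
      unfolding qs by (intro continuous_intros)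
    have "integral {0..1} (\<lambda>u. \<phi> u *\<^sub>R g u) =
        integral {0..1} (\<lambda>u. \<phi> u *\<^sub>R g u) - integral {0..1} (\<lambda>u. q u *\<^sub>R g u)"
      using q0 by simp
    also have "\<dots> = integral {0..1} (\<lambda>u. \<phi> u *\<^sub>R g u - q u *\<^sub>R g u)"
      by (intro integral_diff[symmetric] integrable_continuous_real continuous_intros g \<phi> cq)
    finally have "norm (integral {0..1} (\<lambda>u. \<phi> u *\<^sub>R g u)) =
        norm (integral {0..1} (\<lambda>u. \<phi> u *\<^sub>R g u - q u *\<^sub>R g u))" by simp
    also have "\<dots> \<le> e * (1 - 0)"
    proof (rule integral_bound)
      show "continuous_on {0..1} (\<lambda>u. \<phi> u *\<^sub>R g u - q u *\<^sub>R g u)"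
        by (intro continuous_intros g \<phi> cq)
      fix u :: real assume u: "u \<in> {0..1}"
      have "norm (\<phi> u *\<^sub>R g u - q u *\<^sub>R g u) = \<bar>\<phi> u - q u\<bar> * norm (g u)"
        by (simp add: scaleR_diff_left[symmetric])
      also have "\<dots> \<le> (e / B) * B"
        using q'[OF u] B(2)[OF u] that B(1) by (intro mult_mono) auto
      finally show "norm (\<phi> u *\<^sub>R g u - q u *\<^sub>R g u) \<le> e" using B(1) by simp
    qed simp
    finally show ?thesis by simp
  qed
  then have "norm (integral {0..1} (\<lambda>u. \<phi> u *\<^sub>R g u)) \<le> 0"
    by (metis field_le_epsilon add_0)
  then show ?thesis by simp
qed

text \<open>Testing \<open>g\<close> against a tent function concentrated near \<open>v\<close>
  compares \<open>g v\<close> with a weighted average of \<open>g\<close>, which is zero by the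
  preceding lemma.\<close>

lemma continuous_eq_0_of_moments:
  fixes g :: "real \<Rightarrow> 'a::banach"
  assumes g: "continuous_on {0..1} g"
    and moments: "\<And>n. integral {0..1} (\<lambda>u. u ^ n *\<^sub>R g u) = 0"
    and v: "v \<in> {0..1}"
  shows "g v = 0"
proof -
  have "norm (g v) \<le> e" if e: "e > 0" for e
  proof -
    obtain \<delta> where \<delta>: "\<delta> > 0"
      and close: "\<And>u. u \<in> {0..1} \<Longrightarrow> dist u v < \<delta> \<Longrightarrow> dist (g u) (g v) < e"
      using g v e unfolding continuous_on_iff by blast
    \<comment> \<open>The tent is supported within distance \<delta> of \<open>v\<close>, exactly
      where \<open>g\<close> is \<open>e\<close>-close to \<open>g v\<close>. It is positive at
      \<open>v\<close>, so its integral can be divided out.\<close>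
    define \<phi> where "\<phi> u = max 0 (\<delta> - \<bar>u - v\<bar>)" for u
    have c\<phi>: "continuous_on {0..1} \<phi>"
      unfolding \<phi>_def by (intro continuous_intros)
    have "integral {0..1} \<phi> \<noteq> 0"
    proof
      assume "integral {0..1} \<phi> = 0"
      moreover have "integral {0..1} \<phi> = 0 \<longleftrightarrow> (\<forall>u\<in>{0..1}. \<phi> u = 0)"
        by (rule integral_eq_0_iff[OF c\<phi>]) (auto simp: \<phi>_def)
      ultimately have "\<phi> v = 0" using v by blast
      then show False using \<delta> by (simp add: \<phi>_def)
    qed
    moreover have "integral {0..1} \<phi> \<ge> 0"
      by (intro integral_nonneg integrable_continuous_real c\<phi>) (simp add: \<phi>_def)
    ultimately have pos: "integral {0..1} \<phi> > 0" by simp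
    have "integral {0..1} \<phi> *\<^sub>R g v = integral {0..1} (\<lambda>u. \<phi> u *\<^sub>R g v)"
      using integral_linear[OF integrable_continuous_real[OF c\<phi>], of "\<lambda>r. r *\<^sub>R g v"]
      by (simp add: o_def bounded_linear_scaleR_left)
    also have "\<dots> = integral {0..1} (\<lambda>u. \<phi> u *\<^sub>R g v) - integral {0..1} (\<lambda>u. \<phi> u *\<^sub>R g u)"
      using integral_continuous_eq_0_of_moments[OF g c\<phi> moments] by simp
    also have "\<dots> = integral {0..1} (\<lambda>u. \<phi> u *\<^sub>R g v - \<phi> u *\<^sub>R g u)"
      by (intro integral_diff[symmetric] integrable_continuous_real continuous_intros g c\<phi>)
    also have "norm \<dots> \<le> integral {0..1} (\<lambda>u. \<phi> u * e)"
    proof (intro integral_norm_bound_integral integrable_continuous_real continuous_intros g c\<phi>)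
      fix u :: real assume u: "u \<in> {0..1}"
      have "norm (\<phi> u *\<^sub>R g v - \<phi> u *\<^sub>R g u) = \<phi> u * dist (g u) (g v)"
        by (simp add: scaleR_diff_right[symmetric] dist_norm norm_minus_commute \<phi>_def)
      also have "\<dots> \<le> \<phi> u * e"
        using close[OF u] by (cases "dist u v < \<delta>") (auto simp: \<phi>_def dist_real_def intro!: mult_left_mono)
      finally show "norm (\<phi> u *\<^sub>R g v - \<phi> u *\<^sub>R g u) \<le> \<phi> u * e" .
    qed
    finally have "integral {0..1} \<phi> * norm (g v) \<le> integral {0..1} \<phi> * e"
      using pos by simp
    then show ?thesis using pos by simp
  qed
  then have "norm (g v) \<le> 0" by (metis field_le_epsilon add_0)
  then show ?thesis by simp
qed

text \<open>Lerch's uniqueness theorem. The substitution \<open>u = exp (- t)\<close> turns the Laplace transform of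
  the primitive \<open>F\<close> of \<open>f\<close> at the positive integers into the moments of \<open>g u = F (- ln u)\<close>.\<close>

lemma laplace_eq_0_imp_eq_0:
  fixes f :: "real \<Rightarrow> 'a::banach"
  assumes f: "continuous_on {0..} f"
    and int: "\<And>n::nat. (\<lambda>t. exp (- real n * t) *\<^sub>R f t) integrable_on {0..}"
    and zero: "\<And>n::nat. integral {0..} (\<lambda>t. exp (- real n * t) *\<^sub>R f t) = 0"
    and t: "t \<ge> 0"
  shows "f t = 0"
proof -
  define F where "F t = integral {0..t} f" for t
  \<comment> \<open>The value 0 at \<open>u = 0\<close> is the limit of \<open>F\<close> at
    infinity, so \<open>g\<close> is continuous up to that endpoint. That limit is zero by the case
    \<open>n = 0\<close> of the assumptions.\<close>
  define g where "g u = (if u \<le> 0 then 0 else F (- ln u))" for u :: real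
  have f_int: "f integrable_on {0..}" and f_zero: "integral {0..} f = 0"
    using int[of 0] zero[of 0] by simp_all
  have F_lim: "(F \<longlongrightarrow> 0) at_top"
    using tendsto_integral_at_top[OF f_int] by (simp add: F_def[abs_def] f_zero)
  have F_cont: "continuous_on {0..} F"
    unfolding F_def by (rule continuous_on_primitive[OF f])
  have g_exp: "g (exp (- t)) = F t" for t
    by (simp add: g_def)
  have g_cont: "continuous_on {0..1} g"
    unfolding continuous_on_def
  proof
    fix u :: real assume u: "u \<in> {0..1}"
    show "(g \<longlongrightarrow> g u) (at u within {0..1})"
    proof (cases "u = 0")
      case True
      have "((\<lambda>u::real. F (- ln u)) \<longlongrightarrow> 0) (at_right 0)"
        by (rule filterlim_compose[OF F_lim]) real_asymp
      then have "(g \<longlongrightarrow> 0) (at_right 0)"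
        by (rule Lim_transform_eventually)
           (use eventually_at_right_less[of 0] in \<open>eventually_elim, simp add: g_def\<close>)
      moreover have "at 0 within {0..1} = at_right (0::real)"
        by (rule at_within_Icc_at_right) simp
      ultimately show ?thesis using True by (simp add: g_def)
    next
      case False
      then have u0: "u > 0" using u by simp
      have "continuous_on {0<..1::real} (\<lambda>u. F (- ln u))"
        by (rule continuous_on_compose2[OF F_cont]) (auto intro!: continuous_intros)
      then have "continuous_on {0<..1} g"
        by (rule continuous_on_eq) (auto simp: g_def)
      then have "(g \<longlongrightarrow> g u) (at u within {0<..1})"
        using u0 u by (simp add: continuous_on_def)
      moreover have "at u within {0<..1} = at u within {0..1}"
        by (rule at_within_nhd[of _ "{0<..}"]) (use u0 in auto)
      ultimately show ?thesis by simp
    qed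
  qed
  have moments: "integral {0..1} (\<lambda>u. u ^ n *\<^sub>R g u) = 0" for n
  proof -
    let ?G = "\<lambda>v. integral {v..1} (\<lambda>u. u ^ n *\<^sub>R g u)"
    have hc: "continuous_on {0..1} (\<lambda>u. u ^ n *\<^sub>R g u)"
      by (intro continuous_intros g_cont)
    have G_deriv: "(?G has_vector_derivative - (v ^ n *\<^sub>R g v)) (at v within {0..1})"
      if "v \<in> {0..1}" for v
      by (rule integral_has_vector_derivative'[OF hc that])
    \<comment> \<open>The substitution contributes one more factor \<open>exp (- t)\<close>, so the
      moment of order \<open>n\<close> belongs to the Laplace parameter
      \<open>Suc n\<close>.\<close>
    have subst: "integral {0..T} (\<lambda>t. exp (- real (Suc n) * t) *\<^sub>R F t) = ?G (exp (- T))"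
      if T: "T \<ge> 0" for T
    proof -
      have "((\<lambda>t. exp (- real (Suc n) * t) *\<^sub>R F t) has_integral ?G (exp (- T)) - ?G (exp (- 0))) {0..T}"
      proof (rule fundamental_theorem_of_calculus[OF T])
        fix s assume s: "s \<in> {0..T}"
        have "((\<lambda>t. exp (- t)) has_vector_derivative - exp (- s)) (at s within {0..T})"
          by (auto intro!: derivative_eq_intros simp: has_real_derivative_iff_has_vector_derivative[symmetric])
        moreover have "(?G has_vector_derivative - (exp (- s) ^ n *\<^sub>R g (exp (- s))))
            (at (exp (- s)) within (\<lambda>t. exp (- t)) ` {0..T})"
          by (rule has_vector_derivative_within_subset[OF G_deriv]) (use s in auto)
        ultimately have "(?G \<circ> (\<lambda>t. exp (- t)) has_vector_derivative
            (- exp (- s)) *\<^sub>R (- (exp (- s) ^ n *\<^sub>R g (exp (- s))))) (at s within {0..T})"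
          by (rule vector_diff_chain_within)
        moreover have "exp (- s) * exp (- s) ^ n = exp (- real (Suc n) * s)"
          by (simp add: exp_of_nat_mult[symmetric] exp_add[symmetric] algebra_simps)
        ultimately show "((\<lambda>t. ?G (exp (- t))) has_vector_derivative
            exp (- real (Suc n) * s) *\<^sub>R F s) (at s within {0..T})"
          by (simp add: o_def g_exp)
      qed
      then show ?thesis by (simp add: integral_unique)
    qed
    \<comment> \<open>By \<open>laplace_by_parts\<close> this difference is \<open>Suc n\<close>
      times the truncated transform of \<open>F\<close>, that is, of the truncated moment of
      \<open>g\<close>. Both of its terms tend to 0.\<close>
    have "((\<lambda>T. integral {0..T} (\<lambda>t. exp (- real (Suc n) * t) *\<^sub>R f t) - exp (- real (Suc n) * T) *\<^sub>R F T)
        \<longlongrightarrow> 0 - 0 *\<^sub>R 0) at_top"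
    proof (intro tendsto_diff tendsto_scaleR F_lim)
      show "((\<lambda>T. integral {0..T} (\<lambda>t. exp (- real (Suc n) * t) *\<^sub>R f t)) \<longlongrightarrow> 0) at_top"
        using tendsto_integral_at_top[OF int[of "Suc n"]] zero[of "Suc n"] by simp
      show "((\<lambda>T. exp (- real (Suc n) * T)) \<longlongrightarrow> 0) at_top"
        by real_asymp
    qed
    moreover have "\<forall>\<^sub>F T in at_top. integral {0..T} (\<lambda>t. exp (- real (Suc n) * t) *\<^sub>R f t) -
        exp (- real (Suc n) * T) *\<^sub>R F T = real (Suc n) *\<^sub>R ?G (exp (- T))"
      using eventually_ge_at_top[of 0]
    proof eventually_elim
      case (elim T)
      show ?case
        unfolding laplace_by_parts[OF f elim] subst[OF elim, symmetric] F_def by simp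
    qed
    ultimately have "((\<lambda>T. real (Suc n) *\<^sub>R ?G (exp (- T))) \<longlongrightarrow> 0) at_top"
      using Lim_transform_eventually by fastforce
    moreover have "((\<lambda>T. real (Suc n) *\<^sub>R ?G (exp (- T))) \<longlongrightarrow> real (Suc n) *\<^sub>R ?G 0) at_top"
    proof (rule tendsto_scaleR[OF tendsto_const])
      have "continuous (at 0 within {0..1}) ?G"
        using G_deriv[of 0] by (intro has_vector_derivative_continuous) auto
      then have "(?G \<longlongrightarrow> ?G 0) (at_right 0)"
        by (simp add: continuous_within at_within_Icc_at_right)
      moreover have "filterlim (\<lambda>T::real. exp (- T)) (at_right 0) at_top" by real_asymp
      ultimately show "((\<lambda>T. ?G (exp (- T))) \<longlongrightarrow> ?G 0) at_top"
        by (rule filterlim_compose)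
    qed
    ultimately have "0 = real (Suc n) *\<^sub>R ?G 0"
      by (rule tendsto_unique[OF trivial_limit_at_top_linorder])
    then show ?thesis by simp
  qed
  have F0: "F s = 0" if "s \<ge> 0" for s
    using continuous_eq_0_of_moments[OF g_cont moments, of "exp (- s)"] that
    by (simp add: g_exp)
  \<comment> \<open>The derivative is taken within an interval to the right of 0, so that
    \<open>t = 0\<close> is covered too; there \<open>F\<close> is constantly 0.\<close>
  have "(F has_vector_derivative f t) (at t within {0..t+1})"
    unfolding F_def using t by (intro primitive_has_vector_derivative[OF f]) auto
  then have "((\<lambda>_. 0) has_vector_derivative f t) (at t within {0..t+1})"
    by (rule has_vector_derivative_transform[rotated 2]) (use t F0 in auto)
  then show ?thesis
    using vector_derivative_unique_within_closed_interval[of 0 "t + 1" t "\<lambda>_. 0" "f t" 0] t by simp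
qed

section \<open>From decay of the resolvent to triviality\<close>

text \<open>After multiplication by \<open>s\<close> the bound has order
  \<open>1 + \<kappa> - (\<alpha> + 1) = \<kappa> - \<alpha> < 0\<close>. The shift \<open>b\<close>
  serves both parts of the theorem: it is \<omega> in the first, and the exponential weight in the
  second.\<close>

lemma pseudo_resolvent_decay_imp_eq_0:
  fixes R :: "complex \<Rightarrow> 'a::complex_banach \<Rightarrow>\<^sub>L 'a"
  assumes "\<kappa> < \<alpha>"
    and R: "pseudo_resolvent \<Omega> R" and \<Omega>: "complex_of_real ` {\<omega><..} \<subseteq> \<Omega>" and l: "l \<in> \<Omega>"
    and bound: "\<forall>\<^sub>F s in at_top. norm (R (complex_of_real s) x) \<le> C * s powr \<kappa> * (s - b) powr (- (\<alpha> + 1))"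
  shows "R l x = 0"
proof (rule pseudo_resolvent_eq_0[OF R \<Omega> l])
  have "((\<lambda>s. C * (s * (s powr \<kappa> * (s - b) powr (- (\<alpha> + 1))))) \<longlongrightarrow> C * 0) at_top"
  proof (intro tendsto_mult tendsto_const)
    show "((\<lambda>s. s * (s powr \<kappa> * (s - b) powr (- (\<alpha> + 1)))) \<longlongrightarrow> 0) at_top"
      using \<open>\<kappa> < \<alpha>\<close> by real_asymp
  qed
  moreover have "\<forall>\<^sub>F s in at_top. norm (s *\<^sub>R R (complex_of_real s) x) \<le>
      C * (s * (s powr \<kappa> * (s - b) powr (- (\<alpha> + 1))))"
    using bound eventually_gt_at_top[of 0]
  proof eventually_elim
    case (elim s)
    then have "s * norm (R (complex_of_real s) x) \<le> s * (C * s powr \<kappa> * (s - b) powr (- (\<alpha> + 1)))"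
      by (intro mult_left_mono) auto
    also have "\<dots> = C * (s * (s powr \<kappa> * (s - b) powr (- (\<alpha> + 1))))"
      by (simp only: mult.assoc mult.left_commute)
    finally show ?case using elim by simp
  qed
  ultimately show "((\<lambda>s. s *\<^sub>R R (complex_of_real s) x) \<longlongrightarrow> 0) at_top"
    unfolding mult_zero_right by (rule Lim_null_comparison[rotated])
qed

theorem corollary2p4:
  fixes \<alpha> \<kappa> :: real
  assumes "0 \<le> \<kappa>" and "\<kappa> < \<alpha>"
  shows "(\<forall>(\<omega>::real) (\<Omega>::complex set) (R :: complex \<Rightarrow> ('a::complex_banach \<Rightarrow>\<^sub>L 'a)).
           pseudo_resolvent \<Omega> R \<longrightarrow>
           complex_of_real ` {\<omega><..} \<subseteq> \<Omega> \<longrightarrow>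
           (\<exists>M>0. \<exists>a\<ge>max \<omega> 0. \<forall>n::nat. \<forall>l>a.
              norm (((l - \<omega>) powr (real n + \<alpha> + 1) / Gamma (real n + \<alpha> + 1)) *\<^sub>R
                nth_vector_derivative n (\<lambda>s. R (complex_of_real s) /\<^sub>R (s powr \<kappa>)) l) \<le> M) \<longrightarrow>
           (\<forall>l\<in>\<Omega>. R l = 0)) \<and>
         (\<forall>S :: real \<Rightarrow> ('a \<Rightarrow>\<^sub>L 'a).
           integrated_semigroup \<kappa> S \<longrightarrow>
           (\<lambda>t. norm (S t)) \<in> O[at_right 0](\<lambda>t. t powr \<alpha>) \<longrightarrow>
           (\<forall>t\<ge>0. S t = 0))"
proof (intro conjI allI impI ballI)
  fix \<omega> :: real and \<Omega> :: "complex set" and R :: "complex \<Rightarrow> ('a \<Rightarrow>\<^sub>L 'a)" and l :: complex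
  assume R: "pseudo_resolvent \<Omega> R" and \<Omega>: "complex_of_real ` {\<omega><..} \<subseteq> \<Omega>" and l: "l \<in> \<Omega>"
  assume "\<exists>M>0. \<exists>a\<ge>max \<omega> 0. \<forall>n::nat. \<forall>l>a.
              norm (((l - \<omega>) powr (real n + \<alpha> + 1) / Gamma (real n + \<alpha> + 1)) *\<^sub>R
                nth_vector_derivative n (\<lambda>s. R (complex_of_real s) /\<^sub>R (s powr \<kappa>)) l) \<le> M"
  then obtain M a where a: "a \<ge> max \<omega> 0" and
    M: "\<And>n s. s > a \<Longrightarrow> norm (((s - \<omega>) powr (real n + \<alpha> + 1) / Gamma (real n + \<alpha> + 1)) *\<^sub>R
                nth_vector_derivative n (\<lambda>s. R (complex_of_real s) /\<^sub>R (s powr \<kappa>)) s) \<le> M"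
    by blast
  have G: "Gamma (\<alpha> + 1) > 0" using assms by (intro Gamma_real_pos) auto
  show "R l = 0"
  proof (rule blinfun_eqI)
    fix x
    have "R l x = 0"
    proof (rule pseudo_resolvent_decay_imp_eq_0[OF assms(2) R \<Omega> l])
      show "\<forall>\<^sub>F s in at_top. norm (R (complex_of_real s) x) \<le>
          (M * Gamma (\<alpha> + 1) * norm x) * s powr \<kappa> * (s - \<omega>) powr (- (\<alpha> + 1))"
        using eventually_gt_at_top[of a]
      proof eventually_elim
        case (elim s)
        then have s: "s > 0" "s > \<omega>" using a by auto
        \<comment> \<open>The case \<open>n = 0\<close>, where the iterated derivative is the
          function itself, solved for the norm of the resolvent.\<close>
        have "norm (R (complex_of_real s)) \<le> M * Gamma (\<alpha> + 1) * s powr \<kappa> * (s - \<omega>) powr (- (\<alpha> + 1))"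
          using M[OF elim, of 0] s G
          by (simp add: nth_vector_derivative_def powr_minus_divide[of _ "\<alpha> + 1"] divide_simps mult_ac
              del: minus_add_distrib)
        then show ?case
          using norm_blinfun[of "R (complex_of_real s)" x]
            mult_right_mono[of "norm (R (complex_of_real s))" _ "norm x"]
          by (smt (verit, best) mult.commute mult.left_commute norm_ge_zero)
      qed
    qed
    then show "R l x = blinfun_apply 0 x" by simp
  qed
next
  fix S :: "real \<Rightarrow> ('a \<Rightarrow>\<^sub>L 'a)" and t :: real
  assume "integrated_semigroup \<kappa> S"
  then obtain A where A: "generates_integrated_semigroup \<kappa> A S"
    unfolding integrated_semigroup_def by (rule exE)
  assume O: "(\<lambda>t. norm (S t)) \<in> O[at_right 0](\<lambda>t. t powr \<alpha>)"
    and t: "t \<ge> 0"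
  from A have S_cont: "\<And>x. continuous_on {0..} (\<lambda>t. S t x)"
    unfolding generates_integrated_semigroup_def by (elim conjE) (rule spec)
  from A obtain \<omega> where \<omega>: "\<omega> \<ge> 0" "complex_of_real ` {\<omega><..} \<subseteq> resolvent_set A"
    and int: "\<And>l x. l > \<omega> \<Longrightarrow> (\<lambda>t. exp (- l * t) *\<^sub>R S t x) integrable_on {0..}"
    and res: "\<And>l x. l > \<omega> \<Longrightarrow> resolvent (complex_of_real l) A x =
      (l powr \<kappa>) *\<^sub>R integral {0..} (\<lambda>t. exp (- l * t) *\<^sub>R S t x)"
    unfolding generates_integrated_semigroup_def by (elim conjE exE) simp
  obtain c where c: "c > 0" "\<forall>\<^sub>F t in at_right 0. norm (S t) \<le> c * t powr \<alpha>"
    using O by (auto elim!: landau_o.bigE)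
  then obtain \<delta> where \<delta>: "\<delta> > 0" "\<And>t. 0 < t \<Longrightarrow> t < \<delta> \<Longrightarrow> norm (S t) \<le> c * t powr \<alpha>"
    by (auto simp: eventually_at_right_field)
  \<comment> \<open>Strictly above \<omega>, so that the weighted orbit \<open>f\<close> below is
    itself integrable on the half-line and has a bounded primitive.\<close>
  define b where "b = \<omega> + 1"
  show "S t = 0"
  proof (rule blinfun_eqI)
    fix x
    define f where "f t = exp (- b * t) *\<^sub>R S t x" for t
    have f_cont: "continuous_on {0..} f"
      unfolding f_def by (intro continuous_intros S_cont)
    have f_int: "f integrable_on {0..}"
      unfolding f_def by (rule int) (simp add: b_def)
    have shift: "(\<lambda>t. exp (- p * t) *\<^sub>R f t) = (\<lambda>t. exp (- (b + p) * t) *\<^sub>R S t x)" for p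
      by (simp add: f_def exp_add[symmetric] algebra_simps)
    obtain B where B: "B > 0" "\<And>t. t \<ge> 0 \<Longrightarrow> norm (integral {0..t} f) \<le> B"
      using bounded_primitive[OF f_cont f_int] by blast
    \<comment> \<open>The first entry handles \<open>s < \<delta>\<close>, where the growth bound on
      \<open>S\<close> applies. The second turns the constant bound \<open>B\<close> into a power
      bound for \<open>s \<ge> \<delta>\<close>.\<close>
    define C where "C = max (c * norm x) (B / \<delta> powr (\<alpha> + 1))"
    have F: "norm (integral {0..s} f) \<le> C * s powr (\<alpha> + 1)" if s: "s \<ge> 0" for s
    proof -
      consider "s = 0" | "0 < s" "s < \<delta>" | "s \<ge> \<delta>" using s by linarith
      then show ?thesis
      proof cases
        case 1
        then show ?thesis by simp
      next
        case 2
        let ?K = "c * s powr \<alpha> * norm x"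
        \<comment> \<open>A mean value inequality that asks for the derivative bound only at
          interior points \<open>0 < r < s\<close>, which is where \<open>S\<close> is controlled.
          The constant \<open>?K\<close> times \<open>s\<close> yields the exponent
          \<open>\<alpha> + 1\<close>.\<close>
        have "norm (integral {0..s} f - integral {0..0} f) \<le> ?K * s - ?K * 0"
        proof (rule differentiable_bound_general[where f' = f and \<phi>' = "\<lambda>_. ?K"])
          show "continuous_on {0..s} (\<lambda>s. integral {0..s} f)"
            using continuous_on_primitive[OF f_cont] by (rule continuous_on_subset) auto
          show "((\<lambda>s. integral {0..s} f) has_vector_derivative f r) (at r)" if "0 < r" "r < s" for r
            using primitive_has_vector_derivative[OF f_cont, of r s] that
            by (simp add: at_within_Icc_at)
          show "norm (f r) \<le> ?K" if r: "0 < r" "r < s" for r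
          proof -
            have "norm (f r) \<le> 1 * norm (S r x)"
              unfolding f_def norm_scaleR using r \<omega> by (intro mult_right_mono) (auto simp: b_def mult_le_0_iff)
            also have "\<dots> \<le> norm (S r) * norm x" using norm_blinfun by simp
            also have "norm (S r) \<le> c * r powr \<alpha>" using \<delta>(2) r 2 by simp
            also have "\<dots> \<le> c * s powr \<alpha>"
              using c r assms by (intro mult_left_mono powr_mono2) auto
            finally show ?thesis by (simp add: mult_right_mono)
          qed
        qed (use 2 in \<open>auto intro!: continuous_intros derivative_eq_intros
          simp: has_real_derivative_iff_has_vector_derivative[symmetric]\<close>)
        then have "norm (integral {0..s} f) \<le> (c * norm x) * s powr (\<alpha> + 1)"
          using 2 by (simp add: powr_add mult_ac)
        also have "\<dots> \<le> C * s powr (\<alpha> + 1)"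
          by (intro mult_right_mono) (auto simp: C_def)
        finally show ?thesis .
      next
        case 3
        have "norm (integral {0..s} f) \<le> B / \<delta> powr (\<alpha> + 1) * \<delta> powr (\<alpha> + 1)"
          using B(2)[OF s] \<delta> by simp
        also have "\<dots> \<le> C * s powr (\<alpha> + 1)"
          using 3 \<delta> assms B(1) by (intro mult_mono powr_mono2) (auto simp: C_def le_max_iff_disj)
        finally show ?thesis .
      qed
    qed
    define D where "D = 2 * C * (2 * (\<alpha> + 1)) powr (\<alpha> + 1)"
    \<comment> \<open>The transform of \<open>S\<close> at \<open>s\<close> is that of
      \<open>f\<close> at \<open>p = s - b\<close>, to which \<open>norm_laplace_le\<close> applies
      with \<open>a = \<alpha> + 1\<close>.\<close>
    have bound: "norm (resolvent (complex_of_real s) A x) \<le> D * s powr \<kappa> * (s - b) powr (- (\<alpha> + 1))"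
      if "s > b" for s
    proof -
      have s: "s > \<omega>" "s - b > 0" using that by (auto simp: b_def)
      have "norm (integral {0..} (\<lambda>t. exp (- (s - b) * t) *\<^sub>R f t)) \<le>
          2 * C * (2 * (\<alpha> + 1)) powr (\<alpha> + 1) * (s - b) powr (- (\<alpha> + 1))"
        by (rule norm_laplace_le[OF f_cont f_int s(2) _ _ F])
           (use assms int[OF s(1), of x] shift[of "s - b"] in auto)
      then have "norm (integral {0..} (\<lambda>t. exp (- s * t) *\<^sub>R S t x)) \<le> D * (s - b) powr (- (\<alpha> + 1))"
        unfolding shift D_def by simp
      then have "s powr \<kappa> * norm (integral {0..} (\<lambda>t. exp (- s * t) *\<^sub>R S t x)) \<le>
          s powr \<kappa> * (D * (s - b) powr (- (\<alpha> + 1)))"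
        by (intro mult_left_mono) auto
      then show ?thesis unfolding res[OF s(1)] by (simp add: mult_ac)
    qed
    have R0: "resolvent l A x = 0" if "l \<in> resolvent_set A" for l
      by (rule pseudo_resolvent_decay_imp_eq_0[OF assms(2) pseudo_resolvent_resolvent \<omega>(2) that
            eventually_mono[OF eventually_gt_at_top bound]])
    have "f t = 0"
    proof (rule laplace_eq_0_imp_eq_0[OF f_cont _ _ t])
      fix n :: nat
      have n: "b + real n > \<omega>" by (simp add: b_def)
      show "(\<lambda>t. exp (- real n * t) *\<^sub>R f t) integrable_on {0..}"
        unfolding shift by (rule int[OF n])
      have "resolvent (complex_of_real (b + real n)) A x = 0"
        using \<omega>(2) n by (intro R0) auto
      \<comment> \<open>The parameter \<open>b + real n\<close> is positive, so the factor
        \<open>powr \<kappa>\<close> is nonzero and the integral itself must vanish.\<close>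
      then show "integral {0..} (\<lambda>t. exp (- real n * t) *\<^sub>R f t) = 0"
        unfolding shift using res[OF n] n \<omega>(1) by simp
    qed
    then show "S t x = blinfun_apply 0 x" by (simp add: f_def)
  qed
qed

end
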